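(* Let $(X,u_X)$ be a (not necessarily compact) ultrametric space. For any closed subsets $A,B\subseteq X$, $$d_{\mathrm{H}}^X(A,B)=\inf\left\{t\geq 0:\ A_{\mathfrak{c}(t)}=B_{\mathfrak{c}(t)}\right\},$$ where $A_{\mathfrak{c}(t)}=\{[x]^X_{\mathfrak{c}(t)}:x\in A\}\subseteq X_{\mathfrak{c}(t)}$ (and similarly for $B$). When $X$ is compact, the infimum above can be replaced by a minimum.
   Context: An ultrametric space $(X,u_X)$ is a metric space with $u_X(x,x'')\le\max(u_X(x,x'),u_X(x',x''))$ for all $x,x',x''\in X$. For $t\ge0$ and $x\in X$, $[x]_{\mathfrak{c}(t)}^X=\{x'\in X:u_X(x,x')\le t\}$ is the equivalence class of $x$ under the equivalence relation $x\sim x'$ iff $u_X(x,x')\le t$, and $X_{\mathfrak{c}(t)}$ is the set of all such classes. The Hausdorff distance between two subsets $A,B\subseteq X$ is $d_{\mathrm H}^X(A,B)=\inf\{r>0: B\subseteq A^r,\ A\subseteq B^r\}$, where $A^r=\{x\in X:u_X(x,A)\le r\}$ is the $r$-neighborhood of $A$ and $u_X(x,A)=\inf_{a\in A}u_X(x,a)$.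
   Formalization: For compact X, the claim that the infimum is a minimum is stated only when A and B are both empty or both nonempty; if exactly one is empty, no t satisfies the condition and there is no minimum. *)

theory Defs
  imports "HOL-Analysis.Analysis"
begin

locale Ultrametric_space = Metric_space X u
  for X :: "'a set" and u :: "'a \<Rightarrow> 'a \<Rightarrow> real" +
  assumes ultrametric:
    "\<And>x x' x''. \<lbrakk>x \<in> X; x' \<in> X; x'' \<in> X\<rbrakk> \<Longrightarrow> u x x'' \<le> max (u x x') (u x' x'')"

definition cball_class :: "'a set \<Rightarrow> ('a \<Rightarrow> 'a \<Rightarrow> real) \<Rightarrow> real \<Rightarrow> 'a \<Rightarrow> 'a set" where
  "cball_class X u t x = {x' \<in> X. u x x' \<le> t}"

definition closed_quotient :: "'a set \<Rightarrow> ('a \<Rightarrow> 'a \<Rightarrow> real) \<Rightarrow> real \<Rightarrow> 'a set \<Rightarrow> 'a set set" where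
  "closed_quotient X u t A = cball_class X u t ` A"

text \<open>
  Distances to sets and between sets take values in the extended reals, where the infimum of
  the empty set is \<open>\<infinity>\<close>. This is needed for empty \<open>A\<close> or \<open>B\<close> and for unbounded sets at
  infinite Hausdorff distance. (The library's \<open>infdist\<close> is \<open>0\<close> for the empty set.)
\<close>

definition set_dist :: "('a \<Rightarrow> 'a \<Rightarrow> real) \<Rightarrow> 'a \<Rightarrow> 'a set \<Rightarrow> ereal" where
  "set_dist u x A = (INF a\<in>A. ereal (u x a))"

definition nbhd :: "'a set \<Rightarrow> ('a \<Rightarrow> 'a \<Rightarrow> real) \<Rightarrow> real \<Rightarrow> 'a set \<Rightarrow> 'a set" where
  "nbhd X u r A = {x \<in> X. set_dist u x A \<le> ereal r}"

definition hausdorff_dist :: "'a set \<Rightarrow> ('a \<Rightarrow> 'a \<Rightarrow> real) \<Rightarrow> 'a set \<Rightarrow> 'a set \<Rightarrow> ereal" where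
  "hausdorff_dist X u A B =
     Inf (ereal ` {r. r > 0 \<and> B \<subseteq> nbhd X u r A \<and> A \<subseteq> nbhd X u r B})"

text \<open>The sets \<^term>\<open>cball_class X u t x\<close> are indeed the classes of the relation
  \<open>u x x' \<le> t\<close> on \<open>X\<close>, so \<^term>\<open>closed_quotient X u t X\<close> is the quotient of \<open>X\<close> by it.\<close>

lemma (in Ultrametric_space) equiv_closed_quotient:
  assumes "t \<ge> 0"
  defines "R \<equiv> {(x, x'). x \<in> X \<and> x' \<in> X \<and> u x x' \<le> t}"
  shows "equiv X R" and "A \<subseteq> X \<Longrightarrow> closed_quotient X u t A = A // R"
proof -
  have "trans R"
  proof (rule transI)
    fix x y z assume "(x, y) \<in> R" "(y, z) \<in> R"
    then show "(x, z) \<in> R" unfolding R_def using ultrametric[of x y z] by auto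
  qed
  moreover have "refl_on X R" "sym R" "R \<subseteq> X \<times> X"
    using \<open>t \<ge> 0\<close> by (auto simp: R_def refl_on_def sym_def commute)
  ultimately show "equiv X R" by (simp add: equiv_def)
  show "closed_quotient X u t A = A // R" if "A \<subseteq> X"
  proof -
    have "cball_class X u t x = R `` {x}" if "x \<in> A" for x
      using that \<open>A \<subseteq> X\<close> by (auto simp: cball_class_def R_def)
    then show ?thesis by (auto simp: closed_quotient_def quotient_def)
  qed
qed

end

theory Submission
  imports Defs
begin

text \<open>
  By the strong triangle inequality, \<open>A\<close> and \<open>B\<close> have the same classes at scale \<open>t\<close> iff every
  point of either set is within distance \<open>t\<close> of some point of the other. The neighbourhood
  inclusions at radius \<open>r\<close> say the same with infima that may not be attained, so each condition
  at one scale implies the other one at every larger scale, and the infima agree. On a compact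
  space the distance to a nonempty closed set is attained, so the condition passes to the
  infimum of the admissible scales.
\<close>

text \<open>Serves both inequalities between the two infima: an arbitrarily small slack
  \<open>e\<close> in the scales disappears in the infimum. An empty \<open>T\<close> is covered
  too, its infimum being \<infinity>.\<close>

lemma Inf_ereal_image_le:
  assumes "\<And>t e. t \<in> T \<Longrightarrow> e > 0 \<Longrightarrow> t + e \<in> S"
  shows "Inf (ereal ` S) \<le> Inf (ereal ` T)"
proof (rule Inf_greatest)
  fix z assume "z \<in> ereal ` T"
  then obtain t where t: "t \<in> T" "z = ereal t" by auto
  show "Inf (ereal ` S) \<le> z"
  proof (rule ereal_le_epsilon2)
    fix e :: real assume "0 < e"
    then have "t + e \<in> S" using assms t by blast
    then show "Inf (ereal ` S) \<le> z + ereal e"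
      unfolding t(2) plus_ereal.simps by (intro Inf_lower imageI)
  qed
qed

text \<open>The infimum need not be attained, so a witness costs the slack \<open>e\<close>. The
  premise rules out an empty \<open>A\<close>, whose distance is \<infinity>.\<close>

lemma set_dist_le_imp_ex:
  assumes "set_dist u x A \<le> ereal r" "e > 0"
  shows "\<exists>a\<in>A. u x a \<le> r + e"
proof -
  have "set_dist u x A < ereal (r + e)"
    using assms by (meson ereal_less_le le_less_trans less_add_same_cancel1 less_ereal.simps(1))
  then show ?thesis by (auto simp: set_dist_def INF_less_iff intro: less_imp_le)
qed

lemma set_dist_le_if_mem:
  assumes "a \<in> A" "u x a \<le> r"
  shows "set_dist u x A \<le> ereal r"
  unfolding set_dist_def using assms by (auto intro: INF_lower2)

context Ultrametric_space
begin

text \<open>The strong triangle inequality through \<open>x\<close> or \<open>y\<close> gives the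
  two inclusions; conversely \<open>y\<close> lies in its own class because \<open>t\<close> is
  nonnegative.\<close>

lemma cball_class_eq_iff:
  assumes "x \<in> X" "y \<in> X" "t \<ge> 0"
  shows "cball_class X u t x = cball_class X u t y \<longleftrightarrow> u x y \<le> t"
proof
  assume "cball_class X u t x = cball_class X u t y"
  moreover have "y \<in> cball_class X u t y" using assms by (simp add: cball_class_def)
  ultimately have "y \<in> cball_class X u t x" by simp
  then show "u x y \<le> t" by (simp add: cball_class_def)
next
  assume "u x y \<le> t"
  then show "cball_class X u t x = cball_class X u t y"
    using assms ultrametric[of x y] ultrametric[of y x] commute[of x y]
    unfolding cball_class_def by fastforce
qed

lemma closed_quotient_subset_iff:
  assumes "A \<subseteq> X" "B \<subseteq> X" "t \<ge> 0"
  shows "closed_quotient X u t A \<subseteq> closed_quotient X u t B \<longleftrightarrow> (\<forall>a\<in>A. \<exists>b\<in>B. u a b \<le> t)"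
proof -
  have "cball_class X u t a = cball_class X u t b \<longleftrightarrow> u a b \<le> t" if "a \<in> A" "b \<in> B" for a b
    using that assms by (intro cball_class_eq_iff) auto
  then show ?thesis unfolding closed_quotient_def image_subset_iff image_iff by metis
qed

lemma subset_nbhd_if_closed_quotient_subset:
  assumes "A \<subseteq> X" "B \<subseteq> X" "t \<ge> 0" "t \<le> r"
    and "closed_quotient X u t A \<subseteq> closed_quotient X u t B"
  shows "A \<subseteq> nbhd X u r B"
  using assms unfolding closed_quotient_subset_iff[OF assms(1-3)] nbhd_def
  by (fastforce intro: set_dist_le_if_mem)

lemma closed_quotient_subset_if_subset_nbhd:
  assumes "A \<subseteq> X" "B \<subseteq> X" "r \<ge> 0" "e > 0" and "A \<subseteq> nbhd X u r B"
  shows "closed_quotient X u (r + e) A \<subseteq> closed_quotient X u (r + e) B"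
  using assms closed_quotient_subset_iff[of A B "r + e"] set_dist_le_imp_ex[of u _ B r e]
  by (force simp: nbhd_def)

lemma hausdorff_dist_eq_Inf_closed_quotient:
  assumes "A \<subseteq> X" "B \<subseteq> X"
  shows "hausdorff_dist X u A B
    = Inf (ereal ` {t. t \<ge> 0 \<and> closed_quotient X u t A = closed_quotient X u t B})"
  unfolding hausdorff_dist_def
proof (rule antisym; rule Inf_ereal_image_le)
  fix t e :: real
  assume "t \<in> {t. t \<ge> 0 \<and> closed_quotient X u t A = closed_quotient X u t B}" "e > 0"
  \<comment> \<open>Adding \<open>e\<close> also makes the radius strictly positive, which matters
    at \<open>t = 0\<close>.\<close>
  then show "t + e \<in> {r. r > 0 \<and> B \<subseteq> nbhd X u r A \<and> A \<subseteq> nbhd X u r B}"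
    using assms subset_nbhd_if_closed_quotient_subset[of A B t "t + e"]
      subset_nbhd_if_closed_quotient_subset[of B A t "t + e"] by auto
next
  fix r e :: real
  assume "r \<in> {r. r > 0 \<and> B \<subseteq> nbhd X u r A \<and> A \<subseteq> nbhd X u r B}" "e > 0"
  then show "r + e \<in> {t. t \<ge> 0 \<and> closed_quotient X u t A = closed_quotient X u t B}"
    using assms closed_quotient_subset_if_subset_nbhd[of A B r e]
      closed_quotient_subset_if_subset_nbhd[of B A r e] by auto
qed

lemma compactin_attains_dist:
  assumes "compactin mtopology B" "B \<noteq> {}" "a \<in> X"
  shows "\<exists>b\<in>B. \<forall>b'\<in>B. u a b \<le> u a b'"
proof -
  have "continuous_map mtopology euclideanreal (u a)"
    using continuous_map_mdist[of mtopology Self "\<lambda>_. a" "\<lambda>x. x"] assms(3)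
    by (simp add: mtopology_of_def)
  then have "compact (u a ` B)"
    using image_compactin[OF assms(1)] by (metis compactin_euclidean_iff)
  then show ?thesis using compact_attains_inf[of "u a ` B"] assms(2) by auto
qed

text \<open>A nearest point \<open>b\<close> of \<open>B\<close> to \<open>a\<close> does not depend
  on the scale, so this single \<open>b\<close> works for every \<open>t\<close> in
  \<open>T\<close>. Hence \<open>u a b\<close> is a lower bound of \<open>T\<close>.\<close>

lemma closed_quotient_subset_Inf:
  assumes "A \<subseteq> X" "compactin mtopology B" "T \<noteq> {}" "\<And>t. t \<in> T \<Longrightarrow> t \<ge> 0"
    and "\<And>t. t \<in> T \<Longrightarrow> closed_quotient X u t A \<subseteq> closed_quotient X u t B"
  shows "closed_quotient X u (Inf T) A \<subseteq> closed_quotient X u (Inf T) B"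
proof -
  have BX: "B \<subseteq> X" using assms(2) compactin_subset_topspace by fastforce
  have Inf0: "Inf T \<ge> 0" using assms by (intro cInf_greatest) auto
  have close: "\<exists>b\<in>B. u a b \<le> t" if "a \<in> A" "t \<in> T" for a t
    using that assms closed_quotient_subset_iff[of A B t] BX by blast
  have "\<exists>b\<in>B. u a b \<le> Inf T" if a: "a \<in> A" for a
  proof -
    have "B \<noteq> {}" using close[OF a] assms(3) by blast
    then obtain b where "b \<in> B" and b: "\<And>b'. b' \<in> B \<Longrightarrow> u a b \<le> u a b'"
      using compactin_attains_dist[OF assms(2)] a assms(1) by blast
    have "u a b \<le> Inf T"
      using assms(3) close[OF a] b by (intro cInf_greatest) (auto intro: order_trans)
    with \<open>b \<in> B\<close> show ?thesis by blast
  qed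
  then show ?thesis using closed_quotient_subset_iff[OF assms(1) BX Inf0] by blast
qed

text \<open>Ensures that some scale is admissible: once \<open>t\<close> bounds all distances within
  \<open>A \<union> B\<close>, any point of one set is close enough to any point of the
  other.\<close>

lemma mbounded_imp_closed_quotient_eq:
  assumes "mbounded A" "mbounded B" "A = {} \<longleftrightarrow> B = {}"
  shows "\<exists>t\<ge>0. closed_quotient X u t A = closed_quotient X u t B"
proof (cases "A = {}")
  case True
  with assms(3) show ?thesis by (intro exI[of _ 0]) (simp add: closed_quotient_def)
next
  case False
  with assms(3) have ne: "A \<noteq> {}" "B \<noteq> {}" by auto
  have "mbounded (A \<union> B)" using assms by (simp add: mbounded_Un)
  then obtain t where "A \<union> B \<subseteq> X" and t: "t > 0" "\<And>x y. x \<in> A \<union> B \<Longrightarrow> y \<in> A \<union> B \<Longrightarrow> u x y \<le> t"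
    unfolding mbounded_alt_pos by blast
  have "\<forall>a\<in>A. \<exists>b\<in>B. u a b \<le> t" "\<forall>b\<in>B. \<exists>a\<in>A. u b a \<le> t"
    using ne t(2) by blast+
  then have "closed_quotient X u t A = closed_quotient X u t B"
    using \<open>A \<union> B \<subseteq> X\<close> t(1) by (intro antisym) (simp_all add: closed_quotient_subset_iff)
  with t(1) show ?thesis by (intro exI[of _ t]) auto
qed

end

text \<open>If exactly one of \<open>A\<close> and \<open>B\<close> is empty, no scale is admissible
  and both sides are \<infinity>; hence the emptiness condition in the claim about the
  minimum.\<close>

theorem theorem5p14:
  fixes X :: "'a set" and u :: "'a \<Rightarrow> 'a \<Rightarrow> real" and A B :: "'a set"
  assumes "Ultrametric_space X u"
    and "closedin (Metric_space.mtopology X u) A"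
    and "closedin (Metric_space.mtopology X u) B"
  shows "hausdorff_dist X u A B
           = Inf (ereal ` {t. t \<ge> 0 \<and> closed_quotient X u t A = closed_quotient X u t B}) \<and>
         (compact_space (Metric_space.mtopology X u) \<longrightarrow> (A = {} \<longleftrightarrow> B = {}) \<longrightarrow>
           (\<exists>t \<in> {t. t \<ge> 0 \<and> closed_quotient X u t A = closed_quotient X u t B}.
             (\<forall>s \<in> {t. t \<ge> 0 \<and> closed_quotient X u t A = closed_quotient X u t B}. t \<le> s)
             \<and> hausdorff_dist X u A B = ereal t))"
proof -
  interpret Ultrametric_space X u by fact
  have AX: "A \<subseteq> X" and BX: "B \<subseteq> X"
    using assms(2,3) closedin_subset by fastforce+
  define T where "T = {t. t \<ge> 0 \<and> closed_quotient X u t A = closed_quotient X u t B}"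
  have dist: "hausdorff_dist X u A B = Inf (ereal ` T)"
    unfolding T_def by (rule hausdorff_dist_eq_Inf_closed_quotient[OF AX BX])
  have "\<exists>t\<in>T. (\<forall>s\<in>T. t \<le> s) \<and> hausdorff_dist X u A B = ereal t"
    if "compact_space mtopology" and ne: "A = {} \<longleftrightarrow> B = {}"
  proof -
    have cpt: "compactin mtopology A" "compactin mtopology B"
      using that(1) assms(2,3) by (auto intro: closedin_compact_space)
    then have T: "T \<noteq> {}"
      using mbounded_imp_closed_quotient_eq[OF _ _ ne] compactin_imp_mbounded
      unfolding T_def by blast
    have lower: "Inf T \<le> s" if "s \<in> T" for s
      using that by (intro cInf_lower bdd_belowI[of _ 0]) (auto simp: T_def)
    have "Inf T \<ge> 0" using T by (intro cInf_greatest) (auto simp: T_def)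
    moreover have "closed_quotient X u (Inf T) A = closed_quotient X u (Inf T) B"
      using T cpt AX BX by (intro antisym closed_quotient_subset_Inf) (auto simp: T_def)
    ultimately have "Inf T \<in> T" by (simp add: T_def)
    \<comment> \<open>Being both a member and a lower bound of \<open>T\<close>, the real infimum is
      also the infimum in the extended reals.\<close>
    moreover from this have "Inf (ereal ` T) = ereal (Inf T)"
      using lower by (intro antisym Inf_lower Inf_greatest) auto
    ultimately show ?thesis using lower dist by auto
  qed
  then show ?thesis using dist unfolding T_def by blast
qed

end
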